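(* For the admissible realization of $Z_{5,5}$ determined by $a=1$ and $b=2$, the canonical collinear completion $\widehat Z_5$ is orthogonally equivalent to the projectivized $H_4$ root configuration.
   Context: Work in $\mathbb R^4=\mathbb R^2\oplus\mathbb R^2$ with the standard Euclidean inner product; rays are points of $\mathbb P^3(\mathbb R)$. Two sets of rays are orthogonally equivalent if some element of $O(4)$ maps one onto the other. Let $\phi=(1+\sqrt5)/2$. $\widehat Z_5$ for $a=1$, $b=2$: let $\alpha=2\pi/5$, $\beta=4\pi/5$, $u(\theta)=(\cos\theta,\sin\theta)$, and let $c>0$ be defined by $c^2=-\cos(\alpha-\beta)/\cos(\alpha+\beta)=\phi^{-2}$. For $(i,j)\in\mathbb Z_5^2$ let $A_{ij}=[u(i\alpha-j\beta):-c\,u(i\alpha+j\beta)]$, $B_{ij}=[c\,u(i\alpha-j\beta):u(i\alpha+j\beta)]$, and for $r\in\mathbb Z_5$ let $P_r=[u(\tfrac{\pi}{2}+\tfrac{2\pi r}{5}):0]$, $P'_r=[0:u(\tfrac{\pi}{2}+\tfrac{2\pi r}{5})]$. Then $Z_{5,5}=\{A_{ij}\}\sqcup\{B_{ij}\}$ and $\widehat Z_5=Z_{5,5}\sqcup\{P_r\}\sqcup\{P'_r\}$. The projectivized $H_4$ root configuration is the set of $60$ rays spanned by the $120$ roots of the $H_4$ root system, i.e. (up to orthogonal equivalence) by the vectors $\pm e_i$, $\tfrac12(\pm1,\pm1,\pm1,\pm1)$, and all even permutations of $\tfrac12(\pm\phi,\pm1,\pm\phi^{-1},0)$. *)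

theory Defs
  imports "HOL-Analysis.Analysis" "HOL-Combinatorics.Permutations"
begin

definition golden :: real where
  "golden = (1 + sqrt 5) / 2"

(* A point of the real projective space is a line through the origin; [v] is the
   line spanned by v, and is only used for v different from 0. *)
definition ray :: "real^4 \<Rightarrow> (real^4) set" where
  "ray v = span {v}"

(* orthogonal_transformation means linear and inner-product preserving, so on
   real^4 these maps are exactly the elements of O(4). *)
definition orthogonally_equivalent :: "(real^4) set set \<Rightarrow> (real^4) set set \<Rightarrow> bool" where
  "orthogonally_equivalent S T \<longleftrightarrow>
     (\<exists>f. orthogonal_transformation f \<and> (\<lambda>L. f ` L) ` S = T)"

(* The identification of R^2 + R^2 with R^4. *)
definition pair4 :: "real^2 \<Rightarrow> real^2 \<Rightarrow> real^4" where
  "pair4 x y = vector [x $ 1, x $ 2, y $ 1, y $ 2]"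

definition udir :: "real \<Rightarrow> real^2" where
  "udir \<theta> = vector [cos \<theta>, sin \<theta>]"

(* The positive c with c^2 = - cos (\<alpha> - \<beta>) / cos (\<alpha> + \<beta>).  The pair of angles is
   admissible when this quotient is positive; see coeff_admissible below. *)
definition coeff :: "real \<Rightarrow> real \<Rightarrow> real" where
  "coeff \<alpha> \<beta> = sqrt (- (cos (\<alpha> - \<beta>) / cos (\<alpha> + \<beta>)))"

definition A_ray :: "real \<Rightarrow> real \<Rightarrow> nat \<Rightarrow> nat \<Rightarrow> (real^4) set" where
  "A_ray \<alpha> \<beta> i j = ray (pair4 (udir (real i * \<alpha> - real j * \<beta>))
                              (- (coeff \<alpha> \<beta> *\<^sub>R udir (real i * \<alpha> + real j * \<beta>))))"

definition B_ray :: "real \<Rightarrow> real \<Rightarrow> nat \<Rightarrow> nat \<Rightarrow> (real^4) set" where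
  "B_ray \<alpha> \<beta> i j = ray (pair4 (coeff \<alpha> \<beta> *\<^sub>R udir (real i * \<alpha> - real j * \<beta>))
                              (udir (real i * \<alpha> + real j * \<beta>)))"

(* The angles are multiples of 2 pi / 5, so the rays depend only on i and j modulo 5
   and the representatives 0, ..., 4 of the residue classes suffice. *)
definition Z55 :: "nat \<Rightarrow> nat \<Rightarrow> (real^4) set set" where
  "Z55 a b =
     (let \<alpha> = 2 * pi * real a / 5; \<beta> = 2 * pi * real b / 5 in
        {A_ray \<alpha> \<beta> i j | i j. i < 5 \<and> j < 5} \<union> {B_ray \<alpha> \<beta> i j | i j. i < 5 \<and> j < 5})"

definition P_ray :: "nat \<Rightarrow> (real^4) set" where
  "P_ray r = ray (pair4 (udir (pi / 2 + 2 * pi * real r / 5)) 0)"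

definition P'_ray :: "nat \<Rightarrow> (real^4) set" where
  "P'_ray r = ray (pair4 0 (udir (pi / 2 + 2 * pi * real r / 5)))"

definition Zhat5 :: "(real^4) set set" where
  "Zhat5 = Z55 1 2 \<union> {P_ray r | r. r < 5} \<union> {P'_ray r | r. r < 5}"

definition signs :: "real set" where
  "signs = {1, -1}"

(* The three families have 8, 16 and 96 elements. *)
definition H4_roots :: "(real^4) set" where
  "H4_roots =
     {s *\<^sub>R axis k 1 | s k. s \<in> signs} \<union>
     {(1/2) *\<^sub>R vector [s1, s2, s3, s4] | s1 s2 s3 s4.
        s1 \<in> signs \<and> s2 \<in> signs \<and> s3 \<in> signs \<and> s4 \<in> signs} \<union>
     {(\<chi> k. ((1/2) *\<^sub>R vector [s1 * golden, s2, s3 * inverse golden, 0] :: real^4) $ p k)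
        | s1 s2 s3 p. s1 \<in> signs \<and> s2 \<in> signs \<and> s3 \<in> signs \<and>
                      p permutes UNIV \<and> evenperm p}"

definition H4_rays :: "(real^4) set set" where
  "H4_rays = ray ` H4_roots"

lemma coeff_admissible:
  defines "\<alpha> \<equiv> 2 * pi / 5" and "\<beta> \<equiv> 4 * pi / 5"
  shows "- (cos (\<alpha> - \<beta>) / cos (\<alpha> + \<beta>)) = inverse golden ^ 2" "coeff \<alpha> \<beta> = inverse golden"
proof -
  define x where "x = cos (2 * pi / 5)"
  have xpos: "x > 0" unfolding x_def by (rule cos_gt_zero_pi) (use pi_gt_zero in linarith)+
  have x1: "x < 1"
    unfolding x_def using cos_monotone_0_pi[of 0 "2 * pi / 5"] pi_gt_zero by simp
  have c2: "cos (4 * pi / 5) = 2 * x^2 - 1"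
    using cos_double_cos[of "2 * pi / 5"] by (simp add: x_def)
  have c3: "cos (6 * pi / 5) = 4 * x^3 - 3 * x"
    using cos_treble_cos[of "2 * pi / 5"] by (simp add: x_def)
  have c23: "cos (6 * pi / 5) = cos (4 * pi / 5)"
    using cos_2pi_minus[of "4 * pi / 5"] by (simp add: field_simps)
  have "(x - 1) * (4 * x^2 + 2 * x - 1) = 0"
    using c2 c3 c23 by (simp add: algebra_simps power2_eq_square power3_eq_cube)
  then have q: "4 * x^2 + 2 * x - 1 = 0" using x1 by simp
  then have "(4 * x + 1)^2 = 5" by (simp add: power2_eq_square algebra_simps)
  then have "sqrt 5 = 4 * x + 1" using xpos by (intro real_sqrt_unique) auto
  then have g: "golden = 2 * x + 1" by (simp add: golden_def)
  have dm: "cos (\<alpha> - \<beta>) = x"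
    using cos_minus[of "2 * pi / 5"] by (simp add: \<alpha>_def \<beta>_def x_def)
  have dp: "cos (\<alpha> + \<beta>) = - (x + 1/2)"
    using c23 c2 q by (simp add: \<alpha>_def \<beta>_def)
  have e: "x * (2 * x + 1)^2 = x + 1/2"
  proof -
    have "x * (2 * x + 1)^2 - (x + 1/2) = (x + 1/2) * (4 * x^2 + 2 * x - 1)"
      by (simp add: power2_eq_square algebra_simps)
    then show ?thesis using q by simp
  qed
  have "- (cos (\<alpha> - \<beta>) / cos (\<alpha> + \<beta>)) = x / (x + 1/2)"
    unfolding dm dp by (simp only: divide_minus_right minus_minus)
  also have "\<dots> = x / (x * golden^2)"
    unfolding g e by simp
  also have "\<dots> = inverse golden ^ 2"
    using xpos by (simp add: field_simps)
  finally show r: "- (cos (\<alpha> - \<beta>) / cos (\<alpha> + \<beta>)) = inverse golden ^ 2" .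
  have "golden > 0" using g xpos by simp
  then show "coeff \<alpha> \<beta> = inverse golden"
    unfolding coeff_def r by simp
qed

end

theory Submission
  imports Defs
begin

text \<open>
  Write \<open>\<phi>\<close> for the golden ratio and \<open>s = sin (2 * pi / 5)\<close>, so that \<open>4 * s\<^sup>2 = \<phi> + 2\<close>.
  The orthogonal map is found by sending the orthogonal rays \<open>P\<^sub>0\<close>, \<open>P'\<^sub>0\<close> to the coordinate
  axes \<open>e\<^sub>1\<close>, \<open>e\<^sub>4\<close> and \<open>P\<^sub>1\<close> to a root ray at angle \<open>2 * pi / 5\<close> from \<open>e\<^sub>1\<close>; the image of the
  plane of the five rays \<open>P\<^sub>r\<close> and its orthogonal complement then both meet the root system in a
  decagon. The vectors spanning the rays of \<open>Zhat5\<close> become, once normalized, unit vectors whose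
  doubled coordinates lie in \<open>\<int>[\<phi>]\<close>, and the 60 integral vectors so obtained are, up to sign, the
  doubled roots.
\<close>

section \<open>Coordinates, and rays under scaling and linear maps\<close>

lemma vector_4_nth:
  fixes w x y z :: "'a::zero"
  shows "(vector [w, x, y, z] :: 'a^4) $ 1 = w" "(vector [w, x, y, z] :: 'a^4) $ 2 = x"
    "(vector [w, x, y, z] :: 'a^4) $ 3 = y" "(vector [w, x, y, z] :: 'a^4) $ 4 = z"
  by (simp_all add: vector_def)

lemma ray_scaleR:
  assumes "c \<noteq> 0"
  shows "ray (c *\<^sub>R v) = ray v"
  using span_image_scale[of "{v}" "\<lambda>_. c"] assms by (simp add: ray_def)

lemma ray_eqI:
  assumes "v = c *\<^sub>R w" "c \<noteq> 0"
  shows "ray v = ray w"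
  using assms ray_scaleR by simp

lemma image_ray:
  assumes "linear f"
  shows "f ` ray v = ray (f v)"
  using linear_span_image[OF assms, of "{v}"] by (simp add: ray_def)

section \<open>Even permutations of four entries\<close>

abbreviation swap :: "'a \<Rightarrow> 'a \<Rightarrow> 'a \<Rightarrow> 'a" where
  "swap \<equiv> Transposition.transpose"

text \<open>The order is that of the enumeration in \<open>permutes_4_eq\<close>, so that no reordering is needed.\<close>

definition even_arrangements :: "'a \<Rightarrow> 'a \<Rightarrow> 'a \<Rightarrow> 'a \<Rightarrow> ('a \<times> 'a \<times> 'a \<times> 'a) set" where
  "even_arrangements a b c d =
     {(a,b,c,d), (a,c,d,b), (a,d,b,c), (b,a,d,c), (b,c,a,d), (b,d,c,a),
      (c,b,d,a), (c,a,b,d), (c,d,a,b), (d,b,a,c), (d,c,b,a), (d,a,c,b)}"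

lemma UN_singleton_index: "(\<Union>x\<in>{a}. f x) = f a"
  by simp

text \<open>A permutation is determined by the image \<open>b\<close> of \<open>a\<close> and what
  is left after swapping it back. The union form lets the enumeration proceed by rewriting.\<close>

lemma permutes_insert_UN:
  "{p. p permutes insert a S} = (\<Union>b\<in>insert a S. \<Union>p\<in>{p. p permutes S}. {swap a b \<circ> p})"
  unfolding permutes_insert by (force simp: image_iff)

lemma permutes_4_eq:
  "{p. p permutes (UNIV :: 4 set)} =
     (\<Union>a\<in>{1, 2, 3, 4}. \<Union>b\<in>{2, 3, 4}. \<Union>c\<in>{3, 4}. {swap 1 a \<circ> swap 2 b \<circ> swap 3 c})"
proof -
  have "{p. p permutes {4 :: 4}} = {id}"
    by auto
  then show ?thesis
    unfolding UNIV_4 permutes_insert_UN[of 1] permutes_insert_UN[of 2] permutes_insert_UN[of 3]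
    by (simp only: UN_UN_flatten UN_singleton_index o_assoc comp_id)
qed

text \<open>A transposition is even exactly when it is trivial; the nested equivalence says that the
  number of nontrivial factors is even.\<close>

lemma evenperm_transposes:
  "evenperm (swap a b \<circ> swap c d \<circ> swap e f) \<longleftrightarrow> ((a = b) = (c = d)) = (e = f)"
  by (simp add: evenperm_comp evenperm_swap permutation_compose permutation_swap_id)

lemma even_permutations_4:
  fixes v :: "4 \<Rightarrow> 'a"
  shows "{(v (p 1), v (p 2), v (p 3), v (p 4)) | p. p permutes UNIV \<and> evenperm p} =
    even_arrangements (v 1) (v 2) (v 3) (v 4)" (is "?L = ?R")
proof -
  let ?t = "\<lambda>p. (v (p 1), v (p 2), v (p 3), v (p 4))"
  let ?q = "\<lambda>a b c. swap 1 a \<circ> swap 2 b \<circ> swap (3::4) c"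
  have "?L = (\<Union>p\<in>{p. p permutes UNIV}. if evenperm p then {?t p} else {})"
    by (auto split: if_splits)
  also have "\<dots> = (\<Union>a\<in>{1, 2, 3, 4}. \<Union>b\<in>{2, 3, 4}. \<Union>c\<in>{3, 4}.
      if ((1 = a) = (2 = b)) = (3 = c) then {?t (?q a b c)} else {})"
    by (simp only: permutes_4_eq UN_UN_flatten UN_singleton_index evenperm_transposes)
  also have "\<dots> = ?R"
    by (simp add: Transposition.transpose_def even_arrangements_def del: Un_insert_right)
  finally show ?thesis .
qed

section \<open>Exact arithmetic in Z[phi]\<close>

text \<open>The pair \<open>(a, b)\<close> encodes \<open>a + b * golden\<close>, and \<open>code_vec\<close> reads a quadruple of pairs as doubled
  coordinates, because the roots have half-integral coordinates over \<open>\<int>[\<phi>]\<close>.\<close>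

definition golden_int :: "int \<times> int \<Rightarrow> real" where
  "golden_int = (\<lambda>(a, b). of_int a + of_int b * golden)"

definition golden_neg :: "int \<times> int \<Rightarrow> int \<times> int" where
  "golden_neg = (\<lambda>(a, b). (- a, - b))"

definition golden_add :: "int \<times> int \<Rightarrow> int \<times> int \<Rightarrow> int \<times> int" where
  "golden_add = (\<lambda>(a, b) (c, d). (a + c, b + d))"

definition golden_times :: "int \<times> int \<Rightarrow> int \<times> int" where
  "golden_times = (\<lambda>(a, b). (b, a + b))"

text \<open>Division by \<open>golden + 2\<close>, whose inverse is \<open>(3 - golden) / 5\<close>; meaningful only when exact.\<close>

definition golden_quot :: "int \<times> int \<Rightarrow> int \<times> int" where
  "golden_quot = (\<lambda>(a, b). ((3 * a - b) div 5, (2 * b - a) div 5))"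

type_synonym golden_code = "(int \<times> int) \<times> (int \<times> int) \<times> (int \<times> int) \<times> (int \<times> int)"

definition code_neg :: "golden_code \<Rightarrow> golden_code" where
  "code_neg = (\<lambda>(w, x, y, z). (golden_neg w, golden_neg x, golden_neg y, golden_neg z))"

definition code_vec :: "golden_code \<Rightarrow> real^4" where
  "code_vec = (\<lambda>(w, x, y, z). (1/2) *\<^sub>R vector [golden_int w, golden_int x, golden_int y, golden_int z])"

lemma golden_pos: "golden > 0"
  by (simp add: golden_def add_pos_nonneg)

lemma golden_square: "golden * golden = golden + 1"
  by (simp add: golden_def field_simps)

lemma inverse_golden: "inverse golden = golden - 1"
  using golden_square golden_pos by (simp add: field_simps)

lemma golden_int_neg: "golden_int (golden_neg x) = - golden_int x"
  by (simp add: golden_int_def golden_neg_def split: prod.splits)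

lemma golden_int_add: "golden_int (golden_add x y) = golden_int x + golden_int y"
  by (simp add: golden_int_def golden_add_def algebra_simps split: prod.splits)

lemma golden_int_times: "golden_int (golden_times x) = golden * golden_int x"
proof -
  obtain a b where x: "x = (a, b)" by (cases x)
  have "golden * golden_int x = of_int a * golden + of_int b * (golden * golden)"
    by (simp add: x golden_int_def algebra_simps)
  also have "\<dots> = golden_int (golden_times x)"
    unfolding golden_square by (simp add: x golden_int_def golden_times_def algebra_simps)
  finally show ?thesis ..
qed

lemma ray_code_neg: "ray (code_vec (code_neg x)) = ray (code_vec x)"
  by (rule ray_eqI[of _ "-1"])
    (cases x, simp add: code_vec_def code_neg_def golden_int_neg vec_eq_iff forall_4 vector_4_nth, simp)

section \<open>The 120 roots as codes\<close>

definition axis_codes :: "golden_code set" where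
  "axis_codes = (\<Union>s\<in>{(2, 0), (-2, 0)}. {(s, (0,0), (0,0), (0,0)), ((0,0), s, (0,0), (0,0)),
      ((0,0), (0,0), s, (0,0)), ((0,0), (0,0), (0,0), s)})"

definition unit_codes :: "(int \<times> int) set" where
  "unit_codes = {(1, 0), (-1, 0)}"

text \<open>The third arranged entry encodes \<open>c\<close> times \<open>golden - 1\<close>, which
  equals \<open>inverse golden\<close>.\<close>

definition H4_codes :: "golden_code set" where
  "H4_codes = axis_codes \<union> unit_codes \<times> unit_codes \<times> unit_codes \<times> unit_codes \<union>
     (\<Union>a\<in>unit_codes. \<Union>b\<in>unit_codes. \<Union>c\<in>unit_codes.
        even_arrangements (golden_times a) b (golden_add (golden_times c) (golden_neg c)) (0, 0))"

lemma golden_int_0: "golden_int (0, 0) = 0"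
  by (simp add: golden_int_def)

lemma signs_eq: "signs = golden_int ` unit_codes"
  by (simp add: signs_def unit_codes_def golden_int_def)

lemma H4_axis_roots: "{s *\<^sub>R axis k 1 | s k. s \<in> signs} = code_vec ` axis_codes" (is "?L = ?R")
proof -
  have code_vec_axis:
    "code_vec (s, (0,0), (0,0), (0,0)) = (golden_int s / 2) *\<^sub>R axis 1 1"
    "code_vec ((0,0), s, (0,0), (0,0)) = (golden_int s / 2) *\<^sub>R axis 2 1"
    "code_vec ((0,0), (0,0), s, (0,0)) = (golden_int s / 2) *\<^sub>R axis 3 1"
    "code_vec ((0,0), (0,0), (0,0), s) = (golden_int s / 2) *\<^sub>R axis 4 1" for s
    by (simp_all add: code_vec_def golden_int_0 vec_eq_iff forall_4 vector_4_nth axis_def)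
  have "?L = (\<Union>s\<in>signs. (\<lambda>k. s *\<^sub>R axis k 1) ` UNIV)"
    by blast
  also have "\<dots> = ?R"
    unfolding UNIV_4 signs_def axis_codes_def image_UN image_insert image_empty
    by (simp add: code_vec_axis golden_int_def)
  finally show ?thesis .
qed

lemma H4_half_roots:
  "{(1/2) *\<^sub>R vector [s1, s2, s3, s4] | s1 s2 s3 s4.
      s1 \<in> signs \<and> s2 \<in> signs \<and> s3 \<in> signs \<and> s4 \<in> signs} =
   code_vec ` (unit_codes \<times> unit_codes \<times> unit_codes \<times> unit_codes)"
  (is "?L = ?R")
proof -
  have "?L = {(1/2) *\<^sub>R vector [golden_int a, golden_int b, golden_int c, golden_int d] | a b c d.
      a \<in> unit_codes \<and> b \<in> unit_codes \<and> c \<in> unit_codes \<and> d \<in> unit_codes}"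
    unfolding signs_eq by blast
  also have "\<dots> = {code_vec (a, b, c, d) | a b c d.
      a \<in> unit_codes \<and> b \<in> unit_codes \<and> c \<in> unit_codes \<and> d \<in> unit_codes}"
    by (simp add: code_vec_def)
  also have "\<dots> = ?R"
    by blast
  finally show ?thesis .
qed

lemma image_even_arrangements:
  "(\<lambda>(w, x, y, z). (f w, f x, f y, f z)) ` even_arrangements a b c d =
     even_arrangements (f a) (f b) (f c) (f d)"
  by (simp add: even_arrangements_def)

lemma H4_golden_roots:
  "{(\<chi> k. ((1/2) *\<^sub>R vector [s1 * golden, s2, s3 * inverse golden, 0] :: real^4) $ p k)
      | s1 s2 s3 p. s1 \<in> signs \<and> s2 \<in> signs \<and> s3 \<in> signs \<and> p permutes UNIV \<and> evenperm p} =
   code_vec ` (\<Union>a\<in>unit_codes. \<Union>b\<in>unit_codes. \<Union>c\<in>unit_codes.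
        even_arrangements (golden_times a) b (golden_add (golden_times c) (golden_neg c)) (0, 0))" (is "?L = ?R")
proof -
  define h :: "real \<times> real \<times> real \<times> real \<Rightarrow> real^4"
    where "h = (\<lambda>(w, x, y, z). (1/2) *\<^sub>R vector [w, x, y, z])"
  define v :: "real \<Rightarrow> real \<Rightarrow> real \<Rightarrow> 4 \<Rightarrow> real"
    where "v s1 s2 s3 k = (vector [s1 * golden, s2, s3 * inverse golden, 0] :: real^4) $ k"
    for s1 s2 s3 k
  have h: "(\<chi> k. ((1/2) *\<^sub>R vector [s1 * golden, s2, s3 * inverse golden, 0] :: real^4) $ p k) =
      h (v s1 s2 s3 (p 1), v s1 s2 s3 (p 2), v s1 s2 s3 (p 3), v s1 s2 s3 (p 4))" for s1 s2 s3 p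
    by (simp add: h_def v_def vec_eq_iff forall_4 vector_4_nth)
  have code_vec: "code_vec = (\<lambda>x. h ((\<lambda>(w, x, y, z). (golden_int w, golden_int x, golden_int y, golden_int z)) x))"
    by (simp add: code_vec_def h_def fun_eq_iff)
  have "?L = (\<Union>s1\<in>signs. \<Union>s2\<in>signs. \<Union>s3\<in>signs. h `
      {(v s1 s2 s3 (p 1), v s1 s2 s3 (p 2), v s1 s2 s3 (p 3), v s1 s2 s3 (p 4)) | p.
        p permutes UNIV \<and> evenperm p})"
    unfolding h by blast
  also have "\<dots> = (\<Union>s1\<in>signs. \<Union>s2\<in>signs. \<Union>s3\<in>signs.
      h ` even_arrangements (s1 * golden) s2 (s3 * inverse golden) 0)"
    unfolding even_permutations_4 by (simp add: v_def vector_4_nth)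
  also have "\<dots> = (\<Union>a\<in>unit_codes. \<Union>b\<in>unit_codes. \<Union>c\<in>unit_codes.
      h ` even_arrangements (golden_int (golden_times a)) (golden_int b) (golden_int (golden_add (golden_times c) (golden_neg c))) (golden_int (0, 0)))"
    unfolding signs_eq
    by (simp add: golden_int_times golden_int_add golden_int_neg golden_int_0 inverse_golden algebra_simps)
  also have "\<dots> = ?R"
    unfolding image_UN code_vec image_image image_even_arrangements[symmetric] ..
  finally show ?thesis .
qed

lemma H4_roots_codes: "H4_roots = code_vec ` H4_codes"
  unfolding H4_roots_def H4_codes_def image_Un H4_axis_roots H4_half_roots H4_golden_roots ..

section \<open>Codes for the rays of \<open>Zhat5\<close>\<close>

text \<open>\<open>cos_code\<close> encodes \<open>2 * cos (2 * pi * k / 5)\<close>, while \<open>sin_code\<close> encodes the quotient of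
  \<open>sin (2 * pi * k / 5)\<close> by \<open>sin (2 * pi / 5)\<close>, which unlike the sine itself lies in \<open>\<int>[\<phi>]\<close>.\<close>

definition cos_code :: "nat \<Rightarrow> int \<times> int" where
  "cos_code k = [(2, 0), (-1, 1), (0, -1), (0, -1), (-1, 1)] ! (k mod 5)"

definition sin_code :: "nat \<Rightarrow> int \<times> int" where
  "sin_code k = [(0, 0), (1, 0), (-1, 1), (1, -1), (-1, 0)] ! (k mod 5)"

text \<open>The orthogonal map divides the middle coordinates by \<open>2 * sin_72\<close>; pulling
  out a common factor \<open>2 * sin_72\<close> turns this into division by
  \<open>4 * (sin_72 * sin_72) = golden + 2\<close>.\<close>

definition diff_code :: "nat \<Rightarrow> nat \<Rightarrow> int \<times> int" where
  "diff_code k l = golden_quot (golden_add (cos_code k) (golden_neg (cos_code l)))"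

definition A_code :: "nat \<Rightarrow> nat \<Rightarrow> golden_code" where
  "A_code k l = (golden_times (sin_code k), golden_add (cos_code k) (golden_neg (diff_code k l)),
     golden_times (diff_code k l), golden_neg (sin_code l))"

definition B_code :: "nat \<Rightarrow> nat \<Rightarrow> golden_code" where
  "B_code k l = (sin_code k, golden_times (diff_code k l),
     golden_add (cos_code l) (diff_code k l), golden_times (sin_code l))"

definition P_code :: "nat \<Rightarrow> golden_code" where
  "P_code r = (cos_code r, golden_neg (golden_times (sin_code r)), golden_neg (sin_code r), (0, 0))"

definition P'_code :: "nat \<Rightarrow> golden_code" where
  "P'_code r = ((0, 0), sin_code r, golden_neg (golden_times (sin_code r)), cos_code r)"

text \<open>Modulo \<open>2 * pi\<close>, the angles \<open>i * \<alpha> - j * \<beta>\<close> and \<open>i * \<alpha> + j * \<beta>\<close> with \<open>\<beta> = 2 * \<alpha>\<close> are the multiples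
  \<open>i + 3 * j\<close> and \<open>i + 2 * j\<close> of \<open>\<alpha>\<close>.\<close>

definition Zhat5_codes :: "golden_code set" where
  "Zhat5_codes =
     (\<Union>i\<in>set [0..<5]. \<Union>j\<in>set [0..<5]. {A_code (i + 3 * j) (i + 2 * j)}) \<union>
     (\<Union>i\<in>set [0..<5]. \<Union>j\<in>set [0..<5]. {B_code (i + 3 * j) (i + 2 * j)}) \<union>
     (\<Union>r\<in>set [0..<5]. {P_code r}) \<union> (\<Union>r\<in>set [0..<5]. {P'_code r})"

text \<open>The heart of the proof: both sides are explicit finite sets of integer tuples, so
  evaluation decides that the 120 roots are the 60 transformed vectors and their negatives.\<close>

lemma H4_codes_eq: "H4_codes = Zhat5_codes \<union> code_neg ` Zhat5_codes"
  by code_simp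

text \<open>Certifies that the \<open>div\<close> in \<open>golden_quot\<close> is exact here: the
  25 residue pairs are evaluated, and the codes depend only on residues modulo 5.\<close>

lemma golden_int_diff_code: "(golden + 2) * golden_int (diff_code k l) = golden_int (cos_code k) - golden_int (cos_code l)"
proof -
  have "\<forall>k\<in>set [0..<5]. \<forall>l\<in>set [0..<5].
      golden_add (golden_times (diff_code k l)) (golden_add (diff_code k l) (diff_code k l)) =
      golden_add (cos_code k) (golden_neg (cos_code l))"
    by code_simp
  then have "golden_add (golden_times (diff_code (k mod 5) (l mod 5)))
        (golden_add (diff_code (k mod 5) (l mod 5)) (diff_code (k mod 5) (l mod 5))) =
      golden_add (cos_code (k mod 5)) (golden_neg (cos_code (l mod 5)))"
    by (metis atLeast0LessThan atLeast_upt lessThan_iff mod_less_divisor zero_less_numeral)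
  then have "golden_add (golden_times (diff_code k l)) (golden_add (diff_code k l) (diff_code k l)) =
      golden_add (cos_code k) (golden_neg (cos_code l))"
    by (simp add: diff_code_def cos_code_def)
  from arg_cong[OF this, of golden_int] show ?thesis
    by (simp add: golden_int_add golden_int_neg golden_int_times algebra_simps)
qed

section \<open>Cosine and sine of multiples of 72 degrees\<close>

lemma cos_72: "cos (2 * pi / 5) = (golden - 1) / 2"
proof -
  define x where "x = cos (2 * pi / 5)"
  have x0: "x > 0"
    unfolding x_def by (rule cos_gt_zero_pi) (use pi_gt_zero in linarith)+
  have c: "cos (6 * pi / 5) = 2 * x\<^sup>2 - 1"
    using cos_2pi_minus[of "4 * pi / 5"] cos_double_cos[of "2 * pi / 5"]
    by (simp add: x_def field_simps)
  \<comment> \<open>The formula for the squared coefficient becomes a quadratic equation for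
    \<open>x\<close> over Q(phi); its other root \<open>- golden\<close> is negative.\<close>
  have "- (x / (2 * x\<^sup>2 - 1)) = (golden - 1)\<^sup>2"
    using coeff_admissible(1) cos_minus[of "2 * pi / 5"] c by (simp add: x_def inverse_golden)
  \<comment> \<open>A zero denominator would make the quotient 0 and force
    \<open>golden = 1\<close>.\<close>
  moreover from this have "2 * x\<^sup>2 - 1 \<noteq> 0"
    using golden_square by auto
  ultimately have "- x = (golden - 1)\<^sup>2 * (2 * x\<^sup>2 - 1)"
    by (simp add: field_simps)
  then have "golden\<^sup>2 * (- x) = (golden * (golden - 1))\<^sup>2 * (2 * x\<^sup>2 - 1)"
    by (simp only: power_mult_distrib mult.assoc)
  also have "golden * (golden - 1) = 1"
    using golden_square by (simp add: algebra_simps)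
  finally have "(golden + 1) * (- x) = 2 * x\<^sup>2 - 1"
    by (simp add: power2_eq_square golden_square)
  then have "(2 * x - (golden - 1)) * (x + golden) = 0"
    using golden_square by (simp add: algebra_simps power2_eq_square)
  with x0 golden_pos show ?thesis
    by (simp add: x_def[symmetric] add_pos_pos less_imp_neq[symmetric])
qed

definition sin_72 :: real where
  "sin_72 = sin (2 * pi / 5)"

lemma sin_72_pos: "sin_72 > 0"
  unfolding sin_72_def by (rule sin_gt_zero) (use pi_gt_zero in linarith)+

lemma sin_72_square: "4 * (sin_72 * sin_72) = golden + 2"
proof -
  have "4 * (sin_72 * sin_72) = 4 - 4 * (cos (2 * pi / 5))\<^sup>2"
    using sin_squared_eq[of "2 * pi / 5"] by (simp add: sin_72_def power2_eq_square)
  also have "\<dots> = 4 - (golden * golden - 2 * golden + 1)"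
    unfolding cos_72 by (simp add: power2_eq_square field_simps)
  also have "\<dots> = golden + 2"
    by (simp add: golden_square)
  finally show ?thesis .
qed

lemma udir_fifth:
  "udir (2 * pi * real n / 5) = vector [golden_int (cos_code n) / 2, sin_72 * golden_int (sin_code n)]"
proof -
  have c2: "cos (4 * pi / 5) = - golden / 2"
  proof -
    have "cos (4 * pi / 5) = 2 * ((golden - 1) / 2)\<^sup>2 - 1"
      using cos_double_cos[of "2 * pi / 5"] cos_72 by simp
    also have "\<dots> = (golden * golden - 2 * golden - 1) / 2"
      by (simp add: power2_eq_square field_simps)
    finally show ?thesis
      by (simp add: golden_square)
  qed
  have s2: "sin (4 * pi / 5) = sin_72 * (golden - 1)"
    using sin_double[of "2 * pi / 5"] cos_72 by (simp add: sin_72_def)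
  have refl: "cos (2 * pi - t) = cos t" "sin (2 * pi - t) = - sin t" for t :: real
    by (simp_all add: cos_diff sin_diff)
  \<comment> \<open>The multiples 3 and 4 are reflections of 2 and 1, so \<open>refl\<close> reduces
    them to known values.\<close>
  have angles: "2 * pi * real 0 / 5 = 0" "2 * pi * real 1 / 5 = 2 * pi / 5"
    "2 * pi * real 2 / 5 = 4 * pi / 5" "2 * pi * real 3 / 5 = 2 * pi - 4 * pi / 5"
    "2 * pi * real 4 / 5 = 2 * pi - 2 * pi / 5"
    by simp_all
  have e: "2 * pi * real n / 5 = 2 * pi * real (n mod 5) / 5 + 2 * real (n div 5) * pi"
  proof -
    have "real n = real (n mod 5) + 5 * real (n div 5)"
      by (metis mod_mult_div_eq of_nat_add of_nat_mult of_nat_numeral)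
    then have "2 * pi * real n / 5 = 2 * pi * (real (n mod 5) + 5 * real (n div 5)) / 5"
      by simp
    also have "\<dots> = 2 * pi * real (n mod 5) / 5 + 2 * real (n div 5) * pi"
      by (simp add: field_simps)
    finally show ?thesis .
  qed
  have "n mod 5 \<in> {0, 1, 2, 3, 4}"
    by auto
  then have "cos (2 * pi * real (n mod 5) / 5) = golden_int (cos_code n) / 2 \<and>
      sin (2 * pi * real (n mod 5) / 5) = sin_72 * golden_int (sin_code n)"
    unfolding insert_iff empty_iff
    by (elim disjE; simp only: cos_code_def sin_code_def angles refl c2 s2 cos_72
        sin_72_def[symmetric]; simp add: golden_int_def algebra_simps)
  then show ?thesis
    unfolding udir_def e cos_add[of _ "2 * real (n div 5) * pi"] sin_add[of _ "2 * real (n div 5) * pi"]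
    by (elim conjE) (simp only: cos_2npi sin_2npi mult_1_right mult_zero_right diff_zero add_0_right)
qed

section \<open>The orthogonal map\<close>

text \<open>Coordinates 2 and 4 span \<open>P_ray 0\<close> and \<open>P'_ray 0\<close>. The other
  two are rotated by the angle with cosine \<open>golden / (2 * sin_72)\<close> and sine
  \<open>1 / (2 * sin_72)\<close>; the squares sum to 1 since
  \<open>golden * golden + 1 = golden + 2\<close>.\<close>

definition frame :: "real^4 \<Rightarrow> real^4" where
  "frame x = vector [x $ 2, (golden * x $ 1 - x $ 3) / (2 * sin_72),
     (x $ 1 + golden * x $ 3) / (2 * sin_72), x $ 4]"

lemma orthogonal_transformation_frame: "orthogonal_transformation frame"
  unfolding orthogonal_transformation_def
proof (intro conjI allI)
  show "linear frame"
    by (rule linearI) (simp_all add: frame_def vec_eq_iff forall_4 vector_4_nth add_divide_distrib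
        diff_divide_distrib algebra_simps)
  fix v w :: "real^4"
  have s4: "(2 * sin_72) * (2 * sin_72) = 4 * (sin_72 * sin_72)"
    by simp
  have "(golden * v $ 1 - v $ 3) * (golden * w $ 1 - w $ 3) +
      (v $ 1 + golden * v $ 3) * (w $ 1 + golden * w $ 3) =
      (golden * golden + 1) * (v $ 1 * w $ 1 + v $ 3 * w $ 3)"
    by (simp add: algebra_simps)
  also have "\<dots> = 4 * (sin_72 * sin_72) * (v $ 1 * w $ 1 + v $ 3 * w $ 3)"
    by (simp add: golden_square sin_72_square)
  finally have "((golden * v $ 1 - v $ 3) * (golden * w $ 1 - w $ 3) +
      (v $ 1 + golden * v $ 3) * (w $ 1 + golden * w $ 3)) / (4 * (sin_72 * sin_72)) =
      v $ 1 * w $ 1 + v $ 3 * w $ 3"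
    using sin_72_pos by simp
  then have "(golden * v $ 1 - v $ 3) / (2 * sin_72) * ((golden * w $ 1 - w $ 3) / (2 * sin_72)) +
      (v $ 1 + golden * v $ 3) / (2 * sin_72) * ((w $ 1 + golden * w $ 3) / (2 * sin_72)) =
      v $ 1 * w $ 1 + v $ 3 * w $ 3"
    using s4 by (simp only: times_divide_times_eq add_divide_distrib[symmetric])
  then show "frame v \<bullet> frame w = v \<bullet> w"
    by (simp add: inner_vec_def sum_4 frame_def vector_4_nth)
qed

lemma frame_ray: "frame ` ray v = ray (frame v)"
  using orthogonal_transformation_frame by (intro image_ray orthogonal_transformation_linear)

section \<open>Images of the rays of \<open>Zhat5\<close>\<close>

lemma udir_A_B:
  "udir (real i * (2 * pi / 5) - real j * (4 * pi / 5)) = udir (2 * pi * real (i + 3 * j) / 5)"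
  "udir (real i * (2 * pi / 5) + real j * (4 * pi / 5)) = udir (2 * pi * real (i + 2 * j) / 5)"
proof -
  have e: "2 * pi * real (i + 3 * j) / 5 =
      (real i * (2 * pi / 5) - real j * (4 * pi / 5)) + 2 * real j * pi"
    by (simp add: field_simps)
  show "udir (real i * (2 * pi / 5) - real j * (4 * pi / 5)) = udir (2 * pi * real (i + 3 * j) / 5)"
    unfolding udir_def e cos_add[of _ "2 * real j * pi"] sin_add[of _ "2 * real j * pi"] by simp
  show "udir (real i * (2 * pi / 5) + real j * (4 * pi / 5)) = udir (2 * pi * real (i + 2 * j) / 5)"
    by (simp add: field_simps)
qed

lemma frame_pair4:
  "frame (pair4 x y) = vector [x $ 2, (golden * x $ 1 - y $ 1) / (2 * sin_72),
     (x $ 1 + golden * y $ 1) / (2 * sin_72), y $ 2]"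
  by (simp add: frame_def pair4_def vector_4_nth)

text \<open>Moves \<open>sin_72\<close> from the denominator to the numerator, where it joins the
  factor already carried by the sine coordinates.\<close>

lemma divide_sin_72:
  assumes "a = (golden + 2) * b"
  shows "a / (2 * sin_72) = 2 * sin_72 * b"
  using sin_72_pos by (simp add: assms sin_72_square[symmetric])

lemma golden_square_left: "golden * (golden * x) = golden * x + x"
  by (simp add: golden_square mult.assoc[symmetric] distrib_right)

text \<open>In the application \<open>x\<close>, \<open>x'\<close> are doubled cosines and
  \<open>y\<close>, \<open>y'\<close> sine quotients. The factor pulled out is then the norm of the
  spanning vector, as \<open>1 + 1/golden^2 = (golden + 2)/golden^2\<close>.\<close>

lemma frame_A_vector:
  assumes "(golden + 2) * e = x - x'"
  shows "frame (pair4 (vector [x / 2, sin_72 * y]) (- (inverse golden *\<^sub>R vector [x' / 2, sin_72 * y']))) =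
    (2 * sin_72 * (golden - 1)) *\<^sub>R ((1/2) *\<^sub>R vector [golden * y, x - e, golden * e, - y'])"
proof -
  \<comment> \<open>Eliminating \<open>x'\<close> turns both numerators into multiples of
    \<open>golden + 2\<close>.\<close>
  have x': "x' = x - (golden + 2) * e"
    using assms by simp
  have "(golden * (x / 2) + (golden - 1) * (x' / 2)) / (2 * sin_72) =
      2 * sin_72 * ((golden - 1) * ((x - e) / 2))"
    by (rule divide_sin_72) (simp add: x' field_simps golden_square golden_square_left)
  moreover have "(x / 2 - golden * ((golden - 1) * (x' / 2))) / (2 * sin_72) =
      2 * sin_72 * ((golden - 1) * ((golden * e) / 2))"
    by (rule divide_sin_72) (simp add: x' field_simps golden_square golden_square_left)
  ultimately show ?thesis
    by (simp add: frame_pair4 vec_eq_iff forall_4 vector_4_nth inverse_golden)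
      (simp add: field_simps golden_square golden_square_left)
qed

lemma frame_B_vector:
  assumes "(golden + 2) * e = x - x'"
  shows "frame (pair4 (inverse golden *\<^sub>R vector [x / 2, sin_72 * y]) (vector [x' / 2, sin_72 * y'])) =
    (2 * sin_72 * (golden - 1)) *\<^sub>R ((1/2) *\<^sub>R vector [y, golden * e, x' + e, golden * y'])"
proof -
  have x: "x = x' + (golden + 2) * e"
    using assms by simp
  have "(golden * ((golden - 1) * (x / 2)) - x' / 2) / (2 * sin_72) =
      2 * sin_72 * ((golden - 1) * ((golden * e) / 2))"
    by (rule divide_sin_72) (simp add: x field_simps golden_square golden_square_left)
  moreover have "((golden - 1) * (x / 2) + golden * (x' / 2)) / (2 * sin_72) =
      2 * sin_72 * ((golden - 1) * ((x' + e) / 2))"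
    by (rule divide_sin_72) (simp add: x field_simps golden_square golden_square_left)
  ultimately show ?thesis
    by (simp add: frame_pair4 vec_eq_iff forall_4 vector_4_nth inverse_golden)
      (simp add: field_simps golden_square golden_square_left)
qed

lemma frame_scale_nonzero: "2 * sin_72 * (golden - 1) \<noteq> 0"
  using sin_72_pos golden_pos inverse_golden by (metis inverse_nonzero_iff_nonzero less_irrefl mult_eq_0_iff zero_neq_numeral)

lemma frame_A_ray:
  "frame ` A_ray (2 * pi / 5) (4 * pi / 5) i j = ray (code_vec (A_code (i + 3 * j) (i + 2 * j)))"
  unfolding A_ray_def frame_ray coeff_admissible(2) udir_A_B udir_fifth
    frame_A_vector[OF golden_int_diff_code] ray_scaleR[OF frame_scale_nonzero]
  by (simp add: code_vec_def A_code_def golden_int_neg golden_int_times golden_int_add)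

lemma frame_B_ray:
  "frame ` B_ray (2 * pi / 5) (4 * pi / 5) i j = ray (code_vec (B_code (i + 3 * j) (i + 2 * j)))"
  unfolding B_ray_def frame_ray coeff_admissible(2) udir_A_B udir_fifth
    frame_B_vector[OF golden_int_diff_code] ray_scaleR[OF frame_scale_nonzero]
  by (simp add: code_vec_def B_code_def golden_int_neg golden_int_times golden_int_add)

lemma udir_quarter_turn: "udir (pi / 2 + t) = vector [- (udir t $ 2), udir t $ 1]"
  by (simp add: udir_def cos_add sin_add)

text \<open>The quarter turn puts the sine into a coordinate that \<open>frame\<close> divides by
  \<open>2 * sin_72\<close>, so \<open>sin_72\<close> cancels without rescaling.\<close>

lemma frame_P_ray: "frame ` P_ray r = ray (code_vec (P_code r))"
  unfolding P_ray_def frame_ray udir_quarter_turn udir_fifth frame_pair4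
  by (intro ray_eqI[of _ 1])
    (use sin_72_pos in \<open>auto simp: code_vec_def P_code_def vec_eq_iff forall_4 vector_4_nth
        golden_int_neg golden_int_times golden_int_0 field_simps\<close>)

lemma frame_P'_ray: "frame ` P'_ray r = ray (code_vec (P'_code r))"
  unfolding P'_ray_def frame_ray udir_quarter_turn udir_fifth frame_pair4
  by (intro ray_eqI[of _ 1])
    (use sin_72_pos in \<open>auto simp: code_vec_def P'_code_def vec_eq_iff forall_4 vector_4_nth
        golden_int_neg golden_int_times golden_int_0 field_simps\<close>)

lemma frame_Zhat5: "(\<lambda>L. frame ` L) ` Zhat5 = (\<lambda>x. ray (code_vec x)) ` Zhat5_codes"
proof -
  have UN1: "{f r | r. r < 5} = (\<Union>r\<in>set [0..<5]. {f r})" for f :: "nat \<Rightarrow> (real^4) set"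
    by auto
  have UN2: "{f i j | i j. i < 5 \<and> j < 5} = (\<Union>i\<in>set [0..<5]. \<Union>j\<in>set [0..<5]. {f i j})"
    for f :: "nat \<Rightarrow> nat \<Rightarrow> (real^4) set"
    by (simp add: atLeast0LessThan) blast
  have "2 * pi * real 1 / 5 = 2 * pi / 5" "2 * pi * real 2 / 5 = 4 * pi / 5"
    by simp_all
  then show ?thesis
    unfolding Zhat5_def Z55_def Let_def UN1 UN2
    by (simp only: Zhat5_codes_def image_Un image_UN image_insert image_empty
        frame_A_ray frame_B_ray frame_P_ray frame_P'_ray Un_assoc)
qed

theorem theorem7p3:
  shows "orthogonally_equivalent Zhat5 H4_rays"
proof -
  \<comment> \<open>Negated codes span the same rays, so half of the roots suffice.\<close>
  have "H4_rays = (\<lambda>x. ray (code_vec x)) ` Zhat5_codes"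
    by (simp add: H4_rays_def H4_roots_codes H4_codes_eq image_Un image_image ray_code_neg)
  then have "(\<lambda>L. frame ` L) ` Zhat5 = H4_rays"
    by (simp only: frame_Zhat5)
  then show ?thesis
    unfolding orthogonally_equivalent_def using orthogonal_transformation_frame by blast
qed

end
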